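(* Let $T_n$ denote the first time at which, with perfect play, Maker is guaranteed to have fully claimed a winning set in the Maker-Breaker $(n,\iota)$ game on $\mathbb{Z}^2$. Then for every positive integer $n$, $$T_n \geq \frac{2}{11}\,n - 6.$$
   Context: The Maker-Breaker $(n,\iota)$ game, for a positive integer $n$, is played on the board $\mathbb{Z}^2$. The winning sets are all sets of $n$ consecutive points in a line, horizontally, vertically or diagonally, i.e. all sets $\{v + i d : 0 \leq i \leq n-1\}$ with $v \in \mathbb{Z}^2$ and $d \in \{(1,0),(0,1),(1,1),(1,-1)\}$. Turns are numbered (timed) $t = 1, 2, 3, \ldots$. Maker moves at odd times and Breaker at even times, and at time $t$ the player to move claims exactly $t$ points of the board, none of which has previously been claimed by either player. Both players have complete information about all previous moves. Maker wins if he claims all points of some winning set. Given a strategy $\Phi$ for Breaker and a strategy $\Psi$ for Maker, let $T(\Phi,\Psi)_n$ be the first time $t$ such that, when Breaker plays according to $\Phi$ and Maker according to $\Psi$, Maker has claimed all points of some winning set after the turn at time $t$ (with $T(\Phi,\Psi)_n = \infty$ if this never happens). Define $T_n = \max_{\Phi} \min_{\Psi} T(\Phi,\Psi)_n$, where $\Phi$ ranges over Breaker's strategies and $\Psi$ over Maker's strategies. *)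

theory Defs
  imports Complex_Main "HOL-Library.Extended_Real"
begin

type_synonym point = "int \<times> int"

(* The moves made so far in chronological order: entry i is the set of points claimed at
   time i + 1, so Maker's moves (odd times) are the entries with even index. *)
type_synonym history = "point set list"

definition directions :: "point set" where
  "directions = {(1, 0), (0, 1), (1, 1), (1, -1)}"

definition winning_sets :: "nat \<Rightarrow> point set set" where
  "winning_sets n =
    {(\<lambda>i. (x + int i * a, y + int i * b)) ` {0..<n} | x y a b. (a, b) \<in> directions}"

definition legal_move :: "history \<Rightarrow> point set \<Rightarrow> bool" where
  "legal_move h X \<longleftrightarrow> finite X \<and> card X = length h + 1 \<and> X \<inter> \<Union> (set h) = {}"

definition legal_history :: "history \<Rightarrow> bool" where
  "legal_history h \<longleftrightarrow> (\<forall>i < length h. legal_move (take i h) (h ! i))"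

definition maker_strategy :: "(history \<Rightarrow> point set) \<Rightarrow> bool" where
  "maker_strategy \<Psi> \<longleftrightarrow> (\<forall>h. legal_history h \<and> even (length h) \<longrightarrow> legal_move h (\<Psi> h))"

definition breaker_strategy :: "(history \<Rightarrow> point set) \<Rightarrow> bool" where
  "breaker_strategy \<Phi> \<longleftrightarrow> (\<forall>h. legal_history h \<and> odd (length h) \<longrightarrow> legal_move h (\<Phi> h))"

primrec play :: "(history \<Rightarrow> point set) \<Rightarrow> (history \<Rightarrow> point set) \<Rightarrow> nat \<Rightarrow> history" where
  "play \<Phi> \<Psi> 0 = []"
| "play \<Phi> \<Psi> (Suc t) =
    play \<Phi> \<Psi> t @ [if odd (Suc t) then \<Psi> (play \<Phi> \<Psi> t) else \<Phi> (play \<Phi> \<Psi> t)]"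

definition maker_points :: "history \<Rightarrow> point set" where
  "maker_points h = \<Union> {h ! i | i. i < length h \<and> even i}"

(* The infimum of the empty set in enat is infinity. *)
definition win_time :: "(history \<Rightarrow> point set) \<Rightarrow> (history \<Rightarrow> point set) \<Rightarrow> nat \<Rightarrow> enat" where
  "win_time \<Phi> \<Psi> n =
    Inf {enat t | t. t \<ge> 1 \<and> (\<exists>W \<in> winning_sets n. W \<subseteq> maker_points (play \<Phi> \<Psi> t))}"

(* The infimum is a minimum, and the supremum is a maximum: the board is infinite, so at any
   odd time t >= n Maker can claim a whole winning set in one turn, which bounds all the
   values by n + 1. *)
definition game_time :: "nat \<Rightarrow> enat" where
  "game_time n =
    (SUP \<Phi> \<in> {\<Phi>. breaker_strategy \<Phi>}. INF \<Psi> \<in> {\<Psi>. maker_strategy \<Psi>}. win_time \<Phi> \<Psi> n)"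

end

theory Submission imports Defs begin

text \<open>
  Colour the point \<open>(x, y)\<close> by \<open>x + 2 y\<close> modulo 5. A step in any of the four directions changes
  this residue by a unit, so every five consecutive points of a line meet every residue; assign a
  different residue to each direction. For every line of direction \<open>d\<close> Breaker looks only at the
  points assigned to \<open>d\<close>, and maintains the following after each of his turns: a maximal run of
  Maker's points on the line has a Breaker point at one of its ends if it contains an assigned
  point, and at both ends if it contains two. Restoring this costs at most one point for each
  point that Maker has just claimed. When Maker completes a winning set at time \<open>t\<close>, at most two of
  its assigned points were claimed before that turn, so that \<open>n div 5 \<le> t + 2\<close>.
\<close>

section \<open>Runs on a line\<close>

text \<open>For disjoint \<open>M\<close> and \<open>B\<close> the index \<open>k\<close> is forced
  to be the first one past the run through \<open>i\<close>, so Breaker owns the right end of that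
  run. The nonempty interval also puts \<open>i\<close> in \<open>M\<close>.\<close>

definition blocked_right :: "int set \<Rightarrow> int set \<Rightarrow> int \<Rightarrow> bool" where
  "blocked_right M B i \<longleftrightarrow> (\<exists>k>i. k \<in> B \<and> {i..<k} \<subseteq> M)"

definition blocked_left :: "int set \<Rightarrow> int set \<Rightarrow> int \<Rightarrow> bool" where
  "blocked_left M B i \<longleftrightarrow> (\<exists>k<i. k \<in> B \<and> {k<..i} \<subseteq> M)"

definition line_safe :: "int set \<Rightarrow> int set \<Rightarrow> int set \<Rightarrow> bool" where
  "line_safe C M B \<longleftrightarrow>
    (\<forall>i \<in> C \<inter> M. blocked_left M B i \<or> blocked_right M B i) \<and>
    (\<forall>i \<in> C. \<forall>j \<in> C. i < j \<and> {i..j} \<subseteq> M \<longrightarrow> blocked_left M B i \<and> blocked_right M B j)"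

lemma blocked_right_mono:
  "blocked_right M B i \<Longrightarrow> M \<subseteq> M' \<Longrightarrow> B \<subseteq> B' \<Longrightarrow> blocked_right M' B' i"
  unfolding blocked_right_def by blast

lemma blocked_left_mono:
  "blocked_left M B i \<Longrightarrow> M \<subseteq> M' \<Longrightarrow> B \<subseteq> B' \<Longrightarrow> blocked_left M' B' i"
  unfolding blocked_left_def by blast

lemma not_blocked_right_gap:
  assumes "g \<notin> M" "i \<le> g" "{i..g} \<inter> B = {}"
  shows "\<not> blocked_right M B i"
proof
  assume "blocked_right M B i"
  then obtain k where k: "k > i" "k \<in> B" "{i..<k} \<subseteq> M"
    unfolding blocked_right_def by blast
  show False
  proof (cases "k \<le> g")
    case True
    then have "k \<in> {i..g} \<inter> B" using k by simp
    then show False using assms by blast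
  next
    case False
    then have "g \<in> {i..<k}" using assms by simp
    then show False using k assms by blast
  qed
qed

lemma not_blocked_left_gap:
  assumes "g \<notin> M" "g \<le> i" "{g..i} \<inter> B = {}"
  shows "\<not> blocked_left M B i"
proof
  assume "blocked_left M B i"
  then obtain k where k: "k < i" "k \<in> B" "{k<..i} \<subseteq> M"
    unfolding blocked_left_def by blast
  show False
  proof (cases "k \<ge> g")
    case True
    then have "k \<in> {g..i} \<inter> B" using k by simp
    then show False using assms by blast
  next
    case False
    then have "g \<in> {k<..i}" using assms by simp
    then show False using k assms by blast
  qed
qed

lemma blocked_left_run:
  assumes "blocked_left M B i" "i \<le> j" "{i..j} \<subseteq> M"
  shows "blocked_left M B j"
proof -
  obtain k where k: "k < i" "k \<in> B" "{k<..i} \<subseteq> M"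
    using assms(1) unfolding blocked_left_def by blast
  have "{k<..j} \<subseteq> {k<..i} \<union> {i..j}" by auto
  then have "{k<..j} \<subseteq> M" using k(3) assms(3) by blast
  then show ?thesis using k assms(2) unfolding blocked_left_def by (intro exI[of _ k]) auto
qed

text \<open>
  Breaker's answer \<open>B' - B\<close> to Maker's move \<open>X\<close>: each new assigned point asks for its right end,
  except the leftmost one of a run that is not yet blocked on the left.
\<close>

definition asks_right :: "int set \<Rightarrow> int set \<Rightarrow> int set \<Rightarrow> int \<Rightarrow> bool" where
  "asks_right N M B x \<longleftrightarrow> (\<exists>y\<in>N. y < x \<and> {y..x} \<subseteq> M) \<or> blocked_left M B x"

text \<open>Old blocks survive when both sets grow, so only new points and runs joined by the move
  need care. For assigned points \<open>i < j\<close> of a joined run, the left end is blocked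
  through \<open>i\<close> and the right end through \<open>j\<close>, either by an old block or by
  the answer.\<close>

lemma line_safe_step:
  assumes safe: "line_safe C M B"
    and fin: "finite X"
    and BB: "B \<subseteq> B'"
    and disj: "(M \<union> X) \<inter> B' = {}"
    and answer: "\<And>x. x \<in> C \<inter> X \<Longrightarrow>
      if asks_right (C \<inter> X) (M \<union> X) B x then blocked_right (M \<union> X) B' x
      else blocked_left (M \<union> X) B' x"
  shows "line_safe C (M \<union> X) B'"
proof -
  let ?M = "M \<union> X"
  have disjB: "{i..j} \<subseteq> ?M \<Longrightarrow> {i..j} \<inter> B = {}" for i j
    using disj BB by blast
  have new_left: "blocked_left ?M B' x" if x: "x \<in> C \<inter> X" for x
  proof -
    \<comment> \<open>\<open>y\<close> will be the leftmost new assigned point joined to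
      \<open>x\<close>. With no such point before it, it is either blocked on the left already or
      gets its left end from the answer; the block then passes along the run to
      \<open>x\<close>.\<close>
    let ?Y = "{y \<in> C \<inter> X. y \<le> x \<and> {y..x} \<subseteq> ?M}"
    define y where "y = Min ?Y"
    have finY: "finite ?Y" using fin by simp
    have "x \<in> ?Y" using x by auto
    then have "y \<in> ?Y" unfolding y_def using Min_in[OF finY] by blast
    then have y: "y \<in> C \<inter> X" "y \<le> x" "{y..x} \<subseteq> ?M" by auto
    have first: "\<not> (\<exists>z\<in>C \<inter> X. z < y \<and> {z..y} \<subseteq> ?M)"
    proof
      assume "\<exists>z\<in>C \<inter> X. z < y \<and> {z..y} \<subseteq> ?M"
      then obtain z where z: "z \<in> C \<inter> X" "z < y" "{z..y} \<subseteq> ?M" by blast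
      have "{z..x} \<subseteq> {z..y} \<union> {y..x}" by auto
      then have "{z..x} \<subseteq> ?M" using z(3) y(3) by blast
      then have "z \<in> ?Y" using z y(2) by simp
      then have "y \<le> z" unfolding y_def using finY by simp
      then show False using z(2) by simp
    qed
    have "blocked_left ?M B' y"
    proof (cases "blocked_left ?M B y")
      case True
      then show ?thesis using blocked_left_mono[OF _ order_refl BB] by blast
    next
      case False
      then have "\<not> asks_right (C \<inter> X) ?M B y" using first by (simp add: asks_right_def)
      then show ?thesis using answer[OF y(1)] by simp
    qed
    then show ?thesis using y blocked_left_run by blast
  qed
  have one: "blocked_left ?M B' i \<or> blocked_right ?M B' i" if "i \<in> C \<inter> ?M" for i
  proof (cases "i \<in> X")
    case True
    then show ?thesis using new_left that by blast
  next
    case False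
    then have "blocked_left M B i \<or> blocked_right M B i"
      using safe that unfolding line_safe_def by blast
    then show ?thesis
      using blocked_left_mono[of M B i ?M B'] blocked_right_mono[of M B i ?M B'] BB by blast
  qed
  have two: "blocked_left ?M B' i \<and> blocked_right ?M B' j"
    if ij: "i \<in> C" "j \<in> C" "i < j" "{i..j} \<subseteq> ?M" for i j
  proof (cases "{i..j} \<subseteq> M")
    case True
    then have "blocked_left M B i \<and> blocked_right M B j"
      using safe ij unfolding line_safe_def by blast
    then show ?thesis
      using blocked_left_mono[of M B i ?M B'] blocked_right_mono[of M B j ?M B'] BB by blast
  next
    case False
    \<comment> \<open>The gap \<open>g\<close> separated \<open>i\<close> from \<open>j\<close>
      before the move, and no Breaker point lies between them. So an old block of \<open>i\<close>
      can only be on its left, and one of \<open>j\<close> only on its right.\<close>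
    then obtain g where g: "g \<notin> M" "i \<le> g" "g \<le> j" by (auto simp: subset_iff)
    have "{i..g} \<subseteq> {i..j}" "{g..j} \<subseteq> {i..j}" using g by auto
    then have no: "{i..g} \<inter> B = {}" "{g..j} \<inter> B = {}" using disjB[OF ij(4)] by blast+
    have nr: "\<not> blocked_right M B i" using not_blocked_right_gap[OF g(1,2) no(1)] .
    have nl: "\<not> blocked_left M B j" using not_blocked_left_gap[OF g(1,3) no(2)] .
    have mem: "i \<in> ?M" "j \<in> ?M" using subsetD[OF ij(4)] ij(3) by simp_all
    have old_left: "blocked_left M B i" if "i \<notin> X"
      using safe nr mem ij that unfolding line_safe_def by blast
    have left: "blocked_left ?M B' i"
    proof (cases "i \<in> X")
      case True
      then show ?thesis using new_left ij by blast
    next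
      case False
      then show ?thesis using old_left blocked_left_mono[of M B i ?M B'] BB by blast
    qed
    have right: "blocked_right ?M B' j"
    proof (cases "j \<in> X")
      case True
      \<comment> \<open>A new \<open>i\<close> precedes \<open>j\<close> in the same run; an old
        \<open>i\<close> passes its left block on to \<open>j\<close>. In both cases
        \<open>j\<close> asks for the right end.\<close>
      have "asks_right (C \<inter> X) ?M B j"
      proof (cases "i \<in> X")
        case True
        then show ?thesis using ij unfolding asks_right_def by blast
      next
        case False
        then have "blocked_left ?M B i"
          using old_left blocked_left_mono[of M B i ?M B] by blast
        then show ?thesis
          using blocked_left_run[of ?M B i j] ij unfolding asks_right_def by simp
      qed
      then show ?thesis using answer[of j] True ij by simp
    next
      case False
      then have "blocked_right M B j"
        using safe nl mem ij unfolding line_safe_def by blast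
      then show ?thesis using blocked_right_mono[of M B j ?M B'] BB by blast
    qed
    from left right show ?thesis ..
  qed
  show ?thesis unfolding line_safe_def using one two by blast
qed

text \<open>Two assigned points of one run would need both its ends blocked, but on the side of the
  gap \<open>g\<close> no Breaker point is met. So the points counted lie in different runs, and one
  strictly between two others has gaps on both sides inside the window, hence no block at
  all.\<close>

lemma line_safe_old_points:
  assumes safe: "line_safe C M B"
    and I: "{a..<b} \<inter> B = {}" "\<not> {a..<b} \<subseteq> M"
  shows "card (C \<inter> M \<inter> {a..<b}) \<le> 2"
proof -
  let ?S = "C \<inter> M \<inter> {a..<b}"
  obtain g where g: "a \<le> g" "g < b" "g \<notin> M" using I(2) by (auto simp: subset_iff)
  have noB: "{i..j} \<inter> B = {}" if "a \<le> i" "j < b" for i j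
  proof -
    have "{i..j} \<subseteq> {a..<b}" using that by auto
    then show ?thesis using I(1) by blast
  qed
  have gap: "\<exists>h. i \<le> h \<and> h \<le> j \<and> h \<notin> M" if ij: "i \<in> ?S" "j \<in> ?S" "i < j" for i j
  proof (rule ccontr)
    assume "\<not> ?thesis"
    then have run: "{i..j} \<subseteq> M" by auto
    then have bl: "blocked_left M B i" "blocked_right M B j"
      using safe ij unfolding line_safe_def by blast+
    have "g < i \<or> j < g" using run g by (meson atLeastAtMost_iff not_le subsetD)
    then show False
    proof
      assume "g < i"
      then show False using not_blocked_left_gap[of g M i B] g noB[of g i] bl ij by auto
    next
      assume "j < g"
      then show False using not_blocked_right_gap[of g M j B] g noB[of j g] bl ij by auto
    qed
  qed
  have fin: "finite ?S" by simp
  have "?S \<subseteq> {Min ?S, Max ?S}"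
  proof
    fix j assume j: "j \<in> ?S"
    show "j \<in> {Min ?S, Max ?S}"
    proof (rule ccontr)
      assume "j \<notin> {Min ?S, Max ?S}"
      moreover have "Min ?S \<le> j" "j \<le> Max ?S" using fin j by simp_all
      ultimately have lt: "Min ?S < j" "j < Max ?S" by auto
      have mm: "Min ?S \<in> ?S" "Max ?S \<in> ?S" using Min_in[OF fin] Max_in[OF fin] j by blast+
      obtain h where h: "h \<le> j" "h \<notin> M" "Min ?S \<le> h" using gap[OF mm(1) j lt(1)] by blast
      obtain h' where h': "j \<le> h'" "h' \<notin> M" "h' \<le> Max ?S" using gap[OF j mm(2) lt(2)] by blast
      have "a \<le> h" "h' < b" "a \<le> j" "j < b" using mm h h' j by auto
      then have "\<not> blocked_left M B j" "\<not> blocked_right M B j"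
        using not_blocked_left_gap[OF h(2,1) noB] not_blocked_right_gap[OF h'(2,1) noB] by auto
      then show False using safe j unfolding line_safe_def by blast
    qed
  qed
  then have "card ?S \<le> card {Min ?S, Max ?S}" by (intro card_mono) auto
  also have "\<dots> \<le> 2" by (simp add: card_insert_if)
  finally show ?thesis .
qed

text \<open>Finiteness of \<open>M\<close> gives a first index past \<open>i\<close> outside it. It
  depends only on \<open>M\<close> and \<open>i\<close>, so the block holds whatever else Breaker
  owns.\<close>

lemma blocked_right_end:
  assumes "finite M" "i \<in> M"
  obtains k where "k \<notin> M" "\<And>B. k \<in> B \<Longrightarrow> blocked_right M B i"
proof -
  have "\<exists>m::nat. i + int m \<notin> M"
  proof (rule ccontr)
    assume "\<not> ?thesis"
    then have "range (\<lambda>m::nat. i + int m) \<subseteq> M" by auto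
    moreover have "infinite (range (\<lambda>m::nat. i + int m))"
      by (rule range_inj_infinite) (simp add: inj_def)
    ultimately show False using assms(1) finite_subset by blast
  qed
  then obtain m :: nat where m: "i + int m \<notin> M" "\<And>l. l < m \<Longrightarrow> i + int l \<in> M"
    using exists_least_iff[of "\<lambda>m. i + int m \<notin> M"] by blast
  have "m \<noteq> 0" using m(1) assms(2) by (metis add_0_right of_nat_0)
  moreover have "{i..<i + int m} \<subseteq> M"
  proof
    fix x assume "x \<in> {i..<i + int m}"
    then show "x \<in> M" using m(2)[of "nat (x - i)"] by (simp add: nat_less_iff)
  qed
  ultimately have "blocked_right M B i" if "i + int m \<in> B" for B
    unfolding blocked_right_def using that by (intro exI[of _ "i + int m"]) auto
  then show ?thesis using that m(1) by blast
qed

text \<open>Mirror image of the previous lemma under negation of the indices.\<close>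

lemma blocked_left_end:
  assumes "finite M" "i \<in> M"
  obtains k where "k \<notin> M" "\<And>B. k \<in> B \<Longrightarrow> blocked_left M B i"
proof -
  obtain k where k: "k \<notin> uminus ` M" "\<And>B. k \<in> B \<Longrightarrow> blocked_right (uminus ` M) B (- i)"
    using blocked_right_end[of "uminus ` M" "- i"] assms by blast
  have "blocked_left M B i" if "- k \<in> B" for B
  proof -
    \<comment> \<open>Specialising to the set \<open>{k}\<close> identifies the blocking index as
      \<open>k\<close> itself.\<close>
    obtain l where l: "l > - i" "l \<in> {k}" "{- i..<l} \<subseteq> uminus ` M"
      using k(2)[of "{k}"] unfolding blocked_right_def by blast
    have "{- l<..i} \<subseteq> M"
    proof
      fix x assume "x \<in> {- l<..i}"
      then have "- x \<in> uminus ` M" using l(3) by (intro subsetD[OF l(3)]) auto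
      then show "x \<in> M" by auto
    qed
    then show ?thesis using l that unfolding blocked_left_def by (intro exI[of _ "- l"]) auto
  qed
  moreover have "- k \<notin> M" using k(1) by (metis image_eqI minus_minus)
  ultimately show ?thesis using that by blast
qed

section \<open>Lines of the board\<close>

definition ray :: "point \<Rightarrow> point \<Rightarrow> int \<Rightarrow> point" where
  "ray p d i = (fst p + i * fst d, snd p + i * snd d)"

lemma ray_0 [simp]: "ray p d 0 = p"
  by (simp add: ray_def)

lemma ray_ray: "ray (ray p d i) d j = ray p d (i + j)"
  by (simp add: ray_def algebra_simps)

lemma inj_ray: "d \<in> directions \<Longrightarrow> inj (ray p d)"
  by (auto simp: directions_def ray_def inj_def)

lemma finite_ray_vimage: "d \<in> directions \<Longrightarrow> finite A \<Longrightarrow> finite (ray p d -` A)"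
  by (simp add: finite_vimageI inj_ray)

text \<open>Breaker's answer is found with the claimed point as origin of its line, whereas safety
  concerns every base point. This and the following shift lemmas change the origin.\<close>

lemma ray_vimage_shift: "ray (ray p d i) d -` A = (\<lambda>j. i + j) -` ray p d -` A"
  by (auto simp: ray_ray)

lemma shift_subset_iff:
  fixes i :: int
  shows "{a..<b} \<subseteq> (\<lambda>j. i + j) -` M \<longleftrightarrow> {i + a..<i + b} \<subseteq> M"
    and "{a<..b} \<subseteq> (\<lambda>j. i + j) -` M \<longleftrightarrow> {i + a<..i + b} \<subseteq> M"
    and "{a..b} \<subseteq> (\<lambda>j. i + j) -` M \<longleftrightarrow> {i + a..i + b} \<subseteq> M"
  by (simp_all add: ac_simps flip: image_subset_iff_subset_vimage
      atLeastPlusOneAtMost_greaterThanAtMost_int)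

lemma ex_shift: "(\<exists>k::int. P (i + k)) \<longleftrightarrow> (\<exists>k. P k)"
  by (metis add_diff_cancel_left' diff_add_cancel add.commute)

lemma blocked_right_shift:
  "blocked_right ((\<lambda>j. i + j) -` M) ((\<lambda>j. i + j) -` B) 0 \<longleftrightarrow> blocked_right M B i"
  unfolding blocked_right_def shift_subset_iff
  using ex_shift[of "\<lambda>k. k > i \<and> k \<in> B \<and> {i..<k} \<subseteq> M" i] by simp

lemma blocked_left_shift:
  "blocked_left ((\<lambda>j. i + j) -` M) ((\<lambda>j. i + j) -` B) 0 \<longleftrightarrow> blocked_left M B i"
  unfolding blocked_left_def shift_subset_iff
  using ex_shift[of "\<lambda>k. k < i \<and> k \<in> B \<and> {k<..i} \<subseteq> M" i] by simp

lemma asks_right_shift: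
  "asks_right ((\<lambda>j. i + j) -` N) ((\<lambda>j. i + j) -` M) ((\<lambda>j. i + j) -` B) 0 \<longleftrightarrow> asks_right N M B i"
  unfolding asks_right_def shift_subset_iff blocked_left_shift
  using ex_shift[of "\<lambda>y. y \<in> N \<and> y < i \<and> {y..i} \<subseteq> M" i] by (simp add: Bex_def)

text \<open>The residue 4 is not needed; its points are assigned to the direction \<open>(1, -1)\<close> as well.\<close>

definition assigned :: "point \<Rightarrow> point" where
  "assigned p = (let r = (fst p + 2 * snd p) mod 5 in
    if r = 0 then (1, 0) else if r = 1 then (0, 1) else if r = 2 then (1, 1) else (1, -1))"

lemma assigned_in_directions: "assigned p \<in> directions"
  by (simp add: assigned_def directions_def Let_def)

text \<open>Along \<open>d\<close> the residue changes by \<open>s\<close> at each step, and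
  \<open>s\<close> is invertible modulo 5, so the residue belonging to \<open>d\<close> is attained
  with period 5.\<close>

lemma assigned_on_ray:
  assumes "d \<in> directions"
  obtains e where "0 \<le> e" "e < 5" "\<And>q. assigned (ray p d (e + 5 * q)) = d"
proof -
  define c where "c = fst p + 2 * snd p"
  define s where "s = fst d + 2 * snd d"
  obtain r where r: "r \<in> {0..<5}" "\<And>p'. (fst p' + 2 * snd p') mod 5 = r \<Longrightarrow> assigned p' = d"
  proof -
    consider "d = (1, 0)" | "d = (0, 1)" | "d = (1, 1)" | "d = (1, -1)"
      using assms unfolding directions_def by blast
    then show thesis
    proof cases
      case 1
      then show thesis by (intro that[of 0]) (simp_all add: assigned_def)
    next
      case 2
      then show thesis by (intro that[of 1]) (simp_all add: assigned_def)
    next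
      case 3
      then show thesis by (intro that[of 2]) (simp_all add: assigned_def)
    next
      case 4
      then show thesis by (intro that[of 3]) (simp_all add: assigned_def)
    qed
  qed
  have s: "s = 1 \<or> s = 2 \<or> s = 3 \<or> s = -1"
    using assms by (auto simp: directions_def s_def)
  have "\<exists>e. 0 \<le> e \<and> e < 5 \<and> (c + e * s) mod 5 = r"
  proof -
    \<comment> \<open>\<open>u\<close> is an inverse of \<open>s\<close> modulo 5, so
      \<open>u * (r - c)\<close> solves the congruence for \<open>e\<close>.\<close>
    define u where "u = (if s = 1 then 1 else if s = 2 then 3 else if s = 3 then 2 else (-1::int))"
    obtain w where us: "u * s = 1 + 5 * w"
      using s by (elim disjE) (auto simp: u_def intro: that[of 0] that[of 1])
    define e where "e = u * (r - c) mod 5"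
    define q where "q = u * (r - c) div 5"
    have e_eq: "e = u * (r - c) - 5 * q" by (simp add: e_def q_def minus_mult_div_eq_mod)
    have "c + e * s = c + (u * s) * (r - c) - 5 * (q * s)" unfolding e_eq by (simp add: algebra_simps)
    also have "\<dots> = r + 5 * (w * (r - c) - q * s)" unfolding us by (simp add: algebra_simps)
    finally have "(c + e * s) mod 5 = r" using r(1) by (simp only: mod_mult_self2) simp
    then show ?thesis by (intro exI[of _ e]) (simp add: e_def)
  qed
  then obtain e where e: "0 \<le> e" "e < 5" "(c + e * s) mod 5 = r" by blast
  have "assigned (ray p d (e + 5 * q)) = d" for q
  proof (rule r(2))
    have "fst (ray p d (e + 5 * q)) + 2 * snd (ray p d (e + 5 * q)) = (c + e * s) + 5 * (q * s)"
      by (simp add: ray_def c_def s_def algebra_simps)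
    then show "(fst (ray p d (e + 5 * q)) + 2 * snd (ray p d (e + 5 * q))) mod 5 = r"
      using e(3) by simp
  qed
  then show ?thesis using that e by blast
qed

definition assigned_indices :: "point \<Rightarrow> point \<Rightarrow> int set" where
  "assigned_indices p d = {i. assigned (ray p d i) = d}"

lemma assigned_indices_shift:
  "assigned_indices (ray p d i) d = (\<lambda>j. i + j) -` assigned_indices p d"
  by (auto simp: assigned_indices_def ray_ray)

lemma card_assigned_indices:
  assumes "d \<in> directions"
  shows "n div 5 \<le> card (assigned_indices p d \<inter> {0..<int n})"
proof -
  obtain e where e: "0 \<le> e" "e < 5" "\<And>q. assigned (ray p d (e + 5 * q)) = d"
    using assigned_on_ray[OF assms] by blast
  let ?f = "\<lambda>q::nat. e + 5 * int q"
  \<comment> \<open>Since \<open>e < 5\<close>, the index \<open>e + 5 * q\<close> stays below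
    \<open>n\<close> for every \<open>q < n div 5\<close>.\<close>
  have "?f ` {..<n div 5} \<subseteq> assigned_indices p d \<inter> {0..<int n}"
    using e by (auto simp: assigned_indices_def)
  then have "card (?f ` {..<n div 5}) \<le> card (assigned_indices p d \<inter> {0..<int n})"
    by (intro card_mono) auto
  moreover have "inj ?f" by (simp add: inj_def)
  ultimately show ?thesis by (simp add: card_image inj_on_subset[OF _ subset_UNIV])
qed

section \<open>Safe positions on the board and Breaker's answer\<close>

definition safe :: "point set \<Rightarrow> point set \<Rightarrow> bool" where
  "safe M B \<longleftrightarrow>
    (\<forall>p. \<forall>d \<in> directions. line_safe (assigned_indices p d) (ray p d -` M) (ray p d -` B))"

lemma safe_empty: "safe {} {}"
  by (auto simp: safe_def line_safe_def)

lemma safe_answer: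
  assumes "safe M B" "finite M" "finite X" "(M \<union> X) \<inter> B = {}"
  obtains Y where "finite Y" "card Y \<le> card X" "(M \<union> X) \<inter> Y = {}"
    "\<And>B'. B \<union> Y \<subseteq> B' \<Longrightarrow> (M \<union> X) \<inter> B' = {} \<Longrightarrow> safe (M \<union> X) B'"
proof -
  let ?M = "M \<union> X"
  have "\<exists>y. y \<notin> ?M \<and> (\<forall>B'. y \<in> B' \<longrightarrow>
      (let v = (\<lambda>A. ray x (assigned x) -` A) in
       if asks_right (assigned_indices x (assigned x) \<inter> v X) (v ?M) (v B) 0
       then blocked_right (v ?M) (v B') 0 else blocked_left (v ?M) (v B') 0))"
    if x: "x \<in> X" for x
  proof -
    let ?d = "assigned x"
    let ?v = "\<lambda>A. ray x ?d -` A"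
    have fin: "finite (?v ?M)"
      using assms by (intro finite_ray_vimage assigned_in_directions) simp
    have mem: "0 \<in> ?v ?M" using x by simp
    obtain k where k: "k \<notin> ?v ?M" "\<And>B'. k \<in> B' \<Longrightarrow> blocked_right (?v ?M) B' 0"
      using blocked_right_end[OF fin mem] by blast
    obtain l where l: "l \<notin> ?v ?M" "\<And>B'. l \<in> B' \<Longrightarrow> blocked_left (?v ?M) B' 0"
      using blocked_left_end[OF fin mem] by blast
    show ?thesis
    proof (cases "asks_right (assigned_indices x ?d \<inter> ?v X) (?v ?M) (?v B) 0")
      case True
      then show ?thesis using k by (intro exI[of _ "ray x ?d k"]) (simp add: Let_def)
    next
      case False
      then show ?thesis using l by (intro exI[of _ "ray x ?d l"]) (simp add: Let_def)
    qed
  qed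
  then obtain f where f: "\<And>x. x \<in> X \<Longrightarrow> f x \<notin> ?M"
    "\<And>x B' v. x \<in> X \<Longrightarrow> f x \<in> B' \<Longrightarrow> v = (\<lambda>A. ray x (assigned x) -` A) \<Longrightarrow>
       if asks_right (assigned_indices x (assigned x) \<inter> v X) (v ?M) (v B) 0
       then blocked_right (v ?M) (v B') 0 else blocked_left (v ?M) (v B') 0"
    unfolding Let_def by metis
  show ?thesis
  proof (rule that[of "f ` X"])
    show "finite (f ` X)" "card (f ` X) \<le> card X" using assms by (simp_all add: card_image_le)
    show "?M \<inter> f ` X = {}" using f(1) by blast
    fix B' assume B': "B \<union> f ` X \<subseteq> B'" "?M \<inter> B' = {}"
    show "safe ?M B'" unfolding safe_def
    proof (intro allI ballI)
      fix p d assume d: "d \<in> directions"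
      let ?w = "\<lambda>A. ray p d -` A"
      let ?C = "assigned_indices p d"
      have "line_safe ?C (?w M \<union> ?w X) (?w B')"
      proof (rule line_safe_step)
        show "line_safe ?C (?w M) (?w B)" using assms(1) d unfolding safe_def by blast
        show "finite (?w X)" using d assms(3) by (rule finite_ray_vimage)
        show "?w B \<subseteq> ?w B'" "(?w M \<union> ?w X) \<inter> ?w B' = {}" using B' by auto
        fix i assume i: "i \<in> ?C \<inter> ?w X"
        then have x: "assigned (ray p d i) = d" "ray p d i \<in> X" by (auto simp: assigned_indices_def)
        have "f (ray p d i) \<in> B'" using x B' by blast
        \<comment> \<open>The request was stated with the claimed point at index 0; changing the
          origin to \<open>p\<close> moves it to index \<open>i\<close>.\<close>
        from f(2)[OF x(2) this refl]
        show "if asks_right (?C \<inter> ?w X) (?w M \<union> ?w X) (?w B) i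
            then blocked_right (?w M \<union> ?w X) (?w B') i else blocked_left (?w M \<union> ?w X) (?w B') i"
          unfolding x(1) ray_vimage_shift assigned_indices_shift vimage_Int[symmetric] vimage_Un[symmetric]
            asks_right_shift blocked_right_shift blocked_left_shift .
      qed
      then show "line_safe ?C (?w ?M) (?w B')" by (simp add: vimage_Un)
    qed
  qed
qed

text \<open>Every assigned index of the winning set is either among the at most two old ones or
  belongs to the last move \<open>X\<close>. That \<open>W\<close> was incomplete before supplies
  the gap needed for counting the old ones.\<close>

lemma winning_set_bound:
  assumes "safe M B" "finite X" "(M \<union> X) \<inter> B = {}"
    and W: "W \<in> winning_sets n" "W \<subseteq> M \<union> X" "\<not> W \<subseteq> M"
  shows "n div 5 \<le> card X + 2"
proof -
  obtain x y a b where W': "W = (\<lambda>i. (x + int i * a, y + int i * b)) ` {0..<n}"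
    "(a, b) \<in> directions"
    using W(1) by (auto simp: winning_sets_def)
  define p d where "p = (x, y)" and "d = (a, b)"
  have d: "d \<in> directions" using W'(2) d_def by simp
  have Wray: "W = ray p d ` {0..<int n}"
  proof -
    have "{0..<int n} = int ` {0..<n}" by (simp add: image_int_atLeastLessThan)
    then show ?thesis unfolding W'(1) by (simp add: image_image ray_def p_def d_def)
  qed
  let ?w = "\<lambda>A. ray p d -` A"
  let ?C = "assigned_indices p d"
  let ?I = "{0..<int n}"
  have sub: "?I \<subseteq> ?w M \<union> ?w X" using W(2) Wray by auto
  have "card (?C \<inter> ?w M \<inter> ?I) \<le> 2"
  proof (rule line_safe_old_points)
    show "line_safe ?C (?w M) (?w B)" using assms(1) d unfolding safe_def by blast
    show "?I \<inter> ?w B = {}" using sub assms(3) by blast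
    show "\<not> ?I \<subseteq> ?w M" using W(3) Wray by auto
  qed
  moreover have finX: "finite (?w X)" using d assms(2) by (rule finite_ray_vimage)
  moreover have "card (?w X) \<le> card X"
    using card_inj_on_le[of "ray p d" "?w X" X] inj_ray[OF d, of p] assms(2)
    by (simp add: inj_on_subset[OF _ subset_UNIV] image_vimage_subset)
  moreover have "card (?C \<inter> ?I) \<le> card (?w X \<union> (?C \<inter> ?w M \<inter> ?I))"
    using sub finX by (intro card_mono) auto
  moreover have "card (?w X \<union> (?C \<inter> ?w M \<inter> ?I)) \<le> card (?w X) + card (?C \<inter> ?w M \<inter> ?I)"
    by (rule card_Un_le)
  ultimately show ?thesis using card_assigned_indices[OF d, of n p] by linarith
qed

section \<open>Breaker's strategy\<close>

definition breaker_points :: "history \<Rightarrow> point set" where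
  "breaker_points h = \<Union> {h ! i | i. i < length h \<and> odd i}"

lemma maker_points_Nil [simp]: "maker_points [] = {}"
  by (simp add: maker_points_def)

lemma breaker_points_Nil [simp]: "breaker_points [] = {}"
  by (simp add: breaker_points_def)

lemma maker_points_snoc:
  "maker_points (h @ [X]) = (if even (length h) then maker_points h \<union> X else maker_points h)"
  by (auto simp: maker_points_def nth_append less_Suc_eq)

lemma breaker_points_snoc:
  "breaker_points (h @ [X]) = (if odd (length h) then breaker_points h \<union> X else breaker_points h)"
  by (auto simp: breaker_points_def nth_append less_Suc_eq)

lemma points_Un: "maker_points h \<union> breaker_points h = \<Union> (set h)"
  by (induction h rule: rev_induct) (auto simp: maker_points_snoc breaker_points_snoc)

lemma legal_history_snoc:
  "legal_history (h @ [X]) \<longleftrightarrow> legal_history h \<and> legal_move h X"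
  by (auto simp: legal_history_def nth_append less_Suc_eq)

lemma finite_legal_history: "legal_history h \<Longrightarrow> finite (\<Union> (set h))"
  by (induction h rule: rev_induct) (auto simp: legal_history_snoc legal_move_def)

lemma points_disjoint: "legal_history h \<Longrightarrow> maker_points h \<inter> breaker_points h = {}"
proof (induction h rule: rev_induct)
  case (snoc X h)
  then have "X \<inter> (maker_points h \<union> breaker_points h) = {}"
    by (simp add: legal_history_snoc legal_move_def points_Un)
  then show ?case
    using snoc by (auto simp: maker_points_snoc breaker_points_snoc legal_history_snoc)
qed simp

definition safe_history :: "history \<Rightarrow> bool" where
  "safe_history h \<longleftrightarrow> safe (maker_points h) (breaker_points h)"

text \<open>A turn must use its exact number of points; the infinite board provides the
  padding.\<close>

lemma legal_superset:
  assumes "finite (\<Union> (set h))" "finite Y" "card Y \<le> length h + 1" "Y \<inter> \<Union> (set h) = {}"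
  obtains Z where "Y \<subseteq> Z" "legal_move h Z"
proof -
  have "infinite (UNIV :: point set)"
    by (simp add: finite_prod infinite_UNIV_int)
  then have inf: "infinite (- (\<Union> (set h) \<union> Y))"
    unfolding Compl_eq_Diff_UNIV using assms(1,2) by (metis Diff_infinite_finite finite_UnI)
  obtain V where V: "finite V" "card V = length h + 1 - card Y" "V \<subseteq> - (\<Union> (set h) \<union> Y)"
    using infinite_arbitrarily_large[OF inf, of "length h + 1 - card Y"] by auto
  have "card (Y \<union> V) = card Y + card V"
    using V(1,3) assms(2) by (intro card_Un_disjoint) blast+
  then have "card (Y \<union> V) = length h + 1" using V(2) assms(3) by linarith
  moreover have "(Y \<union> V) \<inter> \<Union> (set h) = {}" using V(3) assms(4) by blast
  ultimately have "legal_move h (Y \<union> V)" using V(1) assms(2) by (simp add: legal_move_def)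
  then show ?thesis using that[of "Y \<union> V"] by blast
qed

text \<open>Maker has just claimed \<open>length h\<close> points and Breaker may claim one more, so
  he can afford the safe answer. Safety is only conditional since a strategy must also reply legally
  in positions that were not kept safe.\<close>

lemma safe_reply_exists:
  assumes "legal_history h" "odd (length h)"
  shows "\<exists>Z. legal_move h Z \<and> (safe_history (butlast h) \<longrightarrow> safe_history (h @ [Z]))"
proof -
  obtain g X where h: "h = g @ [X]"
    using assms(2) by (cases h rule: rev_cases) auto
  have g: "even (length g)" "legal_history g" "legal_move g X"
    using assms h by (auto simp: legal_history_snoc)
  have fin: "finite (\<Union> (set h))" using assms(1) by (rule finite_legal_history)
  have M: "maker_points h = maker_points g \<union> X" and B: "breaker_points h = breaker_points g"
    using g h by (simp_all add: maker_points_snoc breaker_points_snoc)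
  have disj: "(maker_points g \<union> X) \<inter> breaker_points g = {}"
    using points_disjoint[OF assms(1)] M B by simp
  show ?thesis
  proof (cases "safe_history g")
    case True
    have "finite (maker_points g)"
      using finite_legal_history[OF g(2)] unfolding points_Un[symmetric] by simp
    moreover have "finite X" "card X = length h" using g(3) h by (auto simp: legal_move_def)
    ultimately obtain Y where Y: "finite Y" "card Y \<le> length h" "(maker_points g \<union> X) \<inter> Y = {}"
      and safe: "\<And>B'. breaker_points g \<union> Y \<subseteq> B' \<Longrightarrow> (maker_points g \<union> X) \<inter> B' = {} \<Longrightarrow>
        safe (maker_points g \<union> X) B'"
      using safe_answer[of "maker_points g" "breaker_points g" X] True disj
      unfolding safe_history_def by metis
    \<comment> \<open>Requested points that Breaker already owns cannot be claimed again.\<close>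
    let ?Y = "Y - breaker_points g"
    have "?Y \<inter> \<Union> (set h) = {}"
      using Y(3) M B unfolding points_Un[symmetric] by blast
    moreover have "card ?Y \<le> length h + 1" using Y card_mono[of Y ?Y] by fastforce
    ultimately obtain Z where Z: "?Y \<subseteq> Z" "legal_move h Z"
      using legal_superset[OF fin, of ?Y] Y by blast
    have "safe (maker_points g \<union> X) (breaker_points g \<union> Z)"
    proof (rule safe)
      have "Z \<inter> \<Union> (set h) = {}" using Z(2) by (simp add: legal_move_def)
      then show "(maker_points g \<union> X) \<inter> (breaker_points g \<union> Z) = {}"
        using disj M B unfolding points_Un[symmetric] by blast
    qed (use Z(1) in blast)
    then have "safe_history (h @ [Z])"
      using M B assms(2) by (simp add: safe_history_def maker_points_snoc breaker_points_snoc)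
    then show ?thesis using Z(2) by blast
  next
    case False
    then show ?thesis using legal_superset[OF fin, of "{}"] h by auto
  qed
qed

definition reply :: "history \<Rightarrow> point set" where
  "reply h = (SOME Z. legal_move h Z \<and> (safe_history (butlast h) \<longrightarrow> safe_history (h @ [Z])))"

lemma reply:
  assumes "legal_history h" "odd (length h)"
  shows "legal_move h (reply h)"
    and "safe_history (butlast h) \<Longrightarrow> safe_history (h @ [reply h])"
  using someI_ex[OF safe_reply_exists[OF assms]] by (auto simp: reply_def)

lemma breaker_strategy_reply: "breaker_strategy reply"
  by (simp add: breaker_strategy_def reply)

section \<open>Play against the safe reply\<close>

lemma length_play [simp]: "length (play \<Phi> \<Psi> t) = t"
  by (induction t) auto

lemma legal_history_play:
  assumes "breaker_strategy \<Phi>" "maker_strategy \<Psi>"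
  shows "legal_history (play \<Phi> \<Psi> t)"
proof (induction t)
  case 0
  show ?case by (simp add: legal_history_def)
next
  case (Suc t)
  then show ?case
    using assms by (auto simp: legal_history_snoc breaker_strategy_def maker_strategy_def)
qed

lemma safe_history_play:
  assumes "maker_strategy \<Psi>"
  shows "safe_history (play reply \<Psi> (2 * m))"
proof (induction m)
  case 0
  show ?case by (simp add: safe_history_def safe_empty)
next
  case (Suc m)
  let ?h = "play reply \<Psi> (Suc (2 * m))"
  have "safe_history (?h @ [reply ?h])"
    using legal_history_play[OF breaker_strategy_reply assms, of "Suc (2 * m)"] Suc
    by (intro reply(2)) auto
  then show ?case by simp
qed

text \<open>Induction on \<open>t\<close> isolates the turn that completes \<open>W\<close>: it is
  Maker's, and the position before it is safe.\<close>

lemma win_bound: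
  assumes \<Psi>: "maker_strategy \<Psi>" and W: "W \<in> winning_sets n"
  shows "W \<subseteq> maker_points (play reply \<Psi> t) \<Longrightarrow> n \<le> 5 * t + 14"
proof (induction t)
  case 0
  then have "W = {}" by simp
  then have "n = 0" using W by (auto simp: winning_sets_def)
  then show ?case by simp
next
  case (Suc t)
  let ?h = "play reply \<Psi> t"
  show ?case
  proof (cases "W \<subseteq> maker_points ?h")
    case True
    then show ?thesis using Suc.IH by simp
  next
    case False
    then have t: "even t" using Suc.prems by (auto simp: maker_points_snoc split: if_splits)
    then obtain m where "t = 2 * m" by (elim evenE)
    then have safe: "safe (maker_points ?h) (breaker_points ?h)"
      using safe_history_play[OF \<Psi>, of m] by (simp add: safe_history_def)
    have legal: "legal_history ?h"
      by (rule legal_history_play[OF breaker_strategy_reply \<Psi>])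
    then have move: "legal_move ?h (\<Psi> ?h)" using \<Psi> t by (simp add: maker_strategy_def)
    have "(maker_points ?h \<union> \<Psi> ?h) \<inter> breaker_points ?h = {}"
      using points_disjoint[OF legal] move unfolding legal_move_def points_Un[symmetric] by blast
    moreover have "W \<subseteq> maker_points ?h \<union> \<Psi> ?h" using Suc.prems t by (simp add: maker_points_snoc)
    ultimately have "n div 5 \<le> card (\<Psi> ?h) + 2"
      using winning_set_bound[OF safe _ _ W _ False] move unfolding legal_move_def by blast
    then have "n div 5 \<le> t + 3" using move by (simp add: legal_move_def)
    \<comment> \<open>\<open>n div 5 \<le> t + 3\<close> gives
      \<open>n \<le> 5 * (t + 3) + 4\<close>, which is \<open>5 * Suc t + 14\<close>.\<close>
    then show ?thesis by presburger
  qed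
qed

theorem theorem1:
  fixes n :: nat
  assumes "n \<ge> 1"
  shows "ereal_of_enat (game_time n) \<ge> ereal (2 / 11 * real n - 6)"
proof -
  \<comment> \<open>With truncated subtraction, \<open>n \<le> 5 * t + 14\<close> yields
    \<open>(n - 10) div 5 \<le> t\<close>, and conversely \<open>n \<le> 5 * m + 14\<close>.\<close>
  define m where "m = (n - 10) div 5"
  have "enat m \<le> win_time reply \<Psi> n" if "maker_strategy \<Psi>" for \<Psi>
    unfolding win_time_def
  proof (rule Inf_greatest, clarify)
    fix t W assume "W \<in> winning_sets n" "W \<subseteq> maker_points (play reply \<Psi> t)"
    then have "n \<le> 5 * t + 14" using win_bound[OF that] by blast
    then have "m \<le> t" unfolding m_def by linarith
    then show "enat m \<le> enat t" by simp
  qed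
  then have "enat m \<le> (INF \<Psi> \<in> {\<Psi>. maker_strategy \<Psi>}. win_time reply \<Psi> n)"
    by (intro INF_greatest) simp
  also have "\<dots> \<le> game_time n"
    unfolding game_time_def using breaker_strategy_reply by (intro SUP_upper) simp
  finally have "ereal_of_enat (enat m) \<le> ereal_of_enat (game_time n)"
    by (simp only: ereal_of_enat_le_iff)
  moreover have "2 / 11 * real n - 6 \<le> real m"
  proof -
    have "n \<le> 5 * m + 14" unfolding m_def by linarith
    then have "real n \<le> 5 * real m + 14" by linarith
    \<comment> \<open>Here \<open>2 / 11 * (5 * m + 14) - 6\<close> equals
      \<open>(10 * m - 38) / 11\<close>, which is below \<open>m\<close>.\<close>
    then show ?thesis by simp
  qed
  then have "ereal (2 / 11 * real n - 6) \<le> ereal_of_enat (enat m)" by simp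
  ultimately show ?thesis by (rule order_trans[rotated])
qed

end
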